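(* Let $N$ be a 3-prime left near-ring and let $d : N \to N$ be a nonzero multiplicative derivation of $N$ such that $[d(x),y] = [d(x),d(y)]$ for all $x,y \in N$. Then $N$ is a commutative ring.
   Context: A (left) near-ring is a set $N$ with two binary operations $+$ and $\cdot$ such that $(N,+)$ is a group (not assumed abelian, written additively with identity $0$), multiplication is associative, and $x(y+z) = xy + xz$ for all $x,y,z \in N$ (right distributivity and a multiplicative identity are not assumed). $N$ is 3-prime if, for $x,y \in N$, $xNy = \{0\}$ (i.e. $xny = 0$ for all $n \in N$) implies $x = 0$ or $y = 0$. For $x,y \in N$, $[x,y] = xy - yx$. A multiplicative derivation of $N$ is a map $d : N \to N$, not assumed additive, with $d(xy) = x d(y) + d(x) y$ for all $x,y \in N$; it is nonzero if it is not identically $0$. That $N$ is a commutative ring means that $(N,+)$ is abelian, multiplication is commutative, and both distributive laws hold (no identity is required). *)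

theory Defs
  imports Main
begin

(* Addition need not commute, right distributivity and 0 * x = 0 are not assumed. *)
class left_near_ring = group_add + semigroup_mult +
  assumes near_ring_distrib_left: "x * (y + z) = x * y + x * z"

definition three_prime :: "'a::left_near_ring itself \<Rightarrow> bool" where
  "three_prime _ \<longleftrightarrow> (\<forall>x y::'a. (\<forall>n. x * n * y = 0) \<longrightarrow> x = 0 \<or> y = 0)"

(* a - b is a + (- b), in this order, in the non-abelian additive group. *)
definition commutator :: "'a::left_near_ring \<Rightarrow> 'a \<Rightarrow> 'a" where
  "commutator x y = x * y - y * x"

definition multiplicative_derivation :: "('a::left_near_ring \<Rightarrow> 'a) \<Rightarrow> bool" where
  "multiplicative_derivation d \<longleftrightarrow> (\<forall>x y. d (x * y) = x * d y + d x * y)"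

end

theory Submission
  imports Defs
begin

text \<open>
  A derivation forces the constant part of \<open>N\<close> to vanish, and by associativity it gives right
  distributivity on the sums \<open>x d(y) + d(x) y\<close>. Putting \<open>d(x) y\<close> for \<open>y\<close> in the hypothesis then yields
  \<open>d(d(x)) N [d(x), z] = 0\<close>, so \<open>d(d(x)) = 0\<close> or \<open>d(x)\<close> is central. The first case reduces to the
  second because antisymmetry of the commutator gives \<open>[d(x), y] = [d(x), d(y)] = [x, d(y)]\<close>; apply
  this with \<open>d(x)\<close> in place of \<open>x\<close>. So all \<open>d(x)\<close> are central, and centrality of \<open>d(xy)\<close> makes every
  element central. With commutative multiplication, expanding \<open>(a + b)(a + a)\<close> in both orders makes
  addition commutative.
\<close>

lemma near_ring_mult_zero_right [simp]: "x * 0 = (0::'a::left_near_ring)"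
  using near_ring_distrib_left[of x 0 0] by (metis add.right_neutral add_left_cancel)

lemma near_ring_mult_minus_right [simp]: "x * (- y) = - (x * y :: 'a::left_near_ring)"
  using near_ring_distrib_left[of x "- y" y] by (simp add: eq_neg_iff_add_eq_0)

lemma near_ring_distrib_left_diff: "x * (y - z) = x * y - x * (z :: 'a::left_near_ring)"
  using near_ring_distrib_left[of x y "- z"] by simp

lemma commutator_eq_0_iff: "commutator x y = 0 \<longleftrightarrow> x * y = y * x"
  by (simp add: commutator_def)

lemma commutator_minus: "- commutator x y = commutator y x"
  by (simp add: commutator_def)

lemma three_primeD:
  assumes "three_prime TYPE('a::left_near_ring)" and "\<And>n. x * n * y = (0::'a)"
  shows "x = 0 \<or> y = 0"
  using assms unfolding three_prime_def by blast

text \<open>Centrality moves \<open>z\<close> past any \<open>n\<close>: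
  \<open>z * n * u = n * (z * u) = 0\<close>, so 3-primeness applies.\<close>

lemma central_mult_eq_0D:
  fixes z :: "'a::left_near_ring"
  assumes "three_prime TYPE('a)" and "\<And>y. z * y = y * z" and "z \<noteq> 0" and "z * u = 0"
  shows "u = 0"
proof -
  have "z * n * u = 0" for n
    using assms(2)[of n] assms(4) by (simp add: mult.assoc)
  then show ?thesis
    using three_primeD[OF assms(1)] assms(3) by blast
qed

lemma central_mult_left_cancel:
  fixes z :: "'a::left_near_ring"
  assumes "three_prime TYPE('a)" and "\<And>y. z * y = y * z" and "z \<noteq> 0" and "z * u = z * v"
  shows "u = v"
  using central_mult_eq_0D[OF assms(1-3), of "u - v"] assms(4)
  by (simp add: near_ring_distrib_left_diff)

lemma derivation_mult:
  "multiplicative_derivation d \<Longrightarrow> d (x * y) = x * d y + d x * y"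
  unfolding multiplicative_derivation_def by blast

lemma derivation_imp_zero_symmetric:
  fixes d :: "'a::left_near_ring \<Rightarrow> 'a"
  assumes d: "multiplicative_derivation d"
  shows "0 * y = (0::'a)"
proof -
  define c where "c = 0 * y"
  \<comment> \<open>Constant elements absorb every left factor, since
    \<open>x * 0 = 0\<close>.\<close>
  have c: "x * c = c" for x
    unfolding c_def by (simp flip: mult.assoc)
  have dc: "d c = x * d c + c" for x
    using derivation_mult[OF d, of x c] c[of x] c[of "d x"] by simp
  \<comment> \<open>Multiplying the instance \<open>x = 0\<close> of \<open>dc\<close> by
    \<open>0\<close> on the left gives \<open>0 * d c = d c\<close>; then that same instance reads
    \<open>d c = d c + c\<close>.\<close>
  have "0 * d c = 0 * (0 * d c + c)"
    using dc by simp
  also have "\<dots> = 0 * d c + c"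
    by (simp add: near_ring_distrib_left c flip: mult.assoc)
  also have "\<dots> = d c"
    using dc[of 0] by simp
  finally show ?thesis
    using dc[of 0] c_def by (metis add.right_neutral add_left_cancel)
qed

text \<open>Expanding \<open>d\<close> on both bracketings of \<open>x * y * z\<close> gives the
  same leading term \<open>x * y * d z\<close>, which cancels on the left.\<close>

lemma derivation_partial_distrib:
  fixes d :: "'a::left_near_ring \<Rightarrow> 'a"
  assumes d: "multiplicative_derivation d"
  shows "(x * d y + d x * y) * z = x * d y * z + d x * y * z"
proof -
  have "x * y * d z + (x * d y + d x * y) * z = d (x * y * z)"
    by (simp add: derivation_mult[OF d])
  also have "\<dots> = d (x * (y * z))"
    by (simp add: mult.assoc)
  also have "\<dots> = x * y * d z + (x * d y * z + d x * y * z)"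
    by (simp add: derivation_mult[OF d] near_ring_distrib_left mult.assoc add.assoc)
  finally show ?thesis by simp
qed

lemma derivation_values_central:
  fixes d :: "'a::left_near_ring \<Rightarrow> 'a"
  assumes prime: "three_prime TYPE('a)" and d: "multiplicative_derivation d"
    and comm: "\<And>x y. commutator (d x) y = commutator (d x) (d y)"
  shows "d x * y = y * d x"
proof -
  have eq: "d (d x) * d x * y = d (d x) * y * d x" for y
  proof -
    have "d x * d x * d y - d x * d y * d x = d x * commutator (d x) (d y)"
      by (simp add: commutator_def near_ring_distrib_left_diff mult.assoc)
    \<comment> \<open>The hypothesis trades \<open>d y\<close> for \<open>y\<close>, after which
      \<open>d x\<close> is absorbed into the second argument.\<close>
    also have "\<dots> = commutator (d x) (d x * y)"
      by (simp add: comm[symmetric]) (simp add: commutator_def near_ring_distrib_left_diff mult.assoc)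
    also have "\<dots> = commutator (d x) (d x * d y + d (d x) * y)"
      by (subst comm) (simp add: derivation_mult[OF d])
    also have "\<dots> = d x * d x * d y + d x * d (d x) * y - (d x * d y * d x + d (d x) * y * d x)"
      by (simp add: commutator_def near_ring_distrib_left derivation_partial_distrib[OF d] mult.assoc)
    \<comment> \<open>Negating a sum reverses its order, so without commuting anything the two
      \<open>d (d x)\<close> terms become adjacent and the outer terms can be cancelled.\<close>
    also have "\<dots> = d x * d x * d y + (d x * d (d x) * y - d (d x) * y * d x) - d x * d y * d x"
      by (simp add: diff_conv_add_uminus minus_add add.assoc del: add_uminus_conv_diff)
    finally have "d x * d x * d y + (d x * d (d x) * y - d (d x) * y * d x) = d x * d x * d y + 0"
      by (simp only: diff_conv_add_uminus add_right_cancel add_0_right)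
    then have "d x * d (d x) * y = d (d x) * y * d x"
      by (simp only: add_left_cancel right_minus_eq)
    moreover have "d x * d (d x) = d (d x) * d x"
      using comm[of x "d x"] by (simp add: commutator_def)
    ultimately show ?thesis by simp
  qed
  have "d (d x) * n * commutator (d x) y = 0" for n y
  proof -
    \<comment> \<open>By \<open>eq\<close>, both sides equal
      \<open>d (d x) * d x * n * y\<close>.\<close>
    have "d (d x) * n * d x * y = d (d x) * n * y * d x"
      using eq[of n] eq[of "n * y"] by (simp add: mult.assoc[symmetric])
    then show ?thesis
      by (simp add: commutator_def near_ring_distrib_left_diff mult.assoc)
  qed
  then consider "d (d x) = 0" | "commutator (d x) y = 0"
    using three_primeD[OF prime] by blast
  then show ?thesis
  proof cases
    case 1
    \<comment> \<open>Both sides equal \<open>commutator (d u) (d y)\<close>; for the right one,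
      apply the hypothesis to \<open>d y\<close> and \<open>u\<close> and negate.\<close>
    have swap: "commutator (d u) y = commutator u (d y)" for u
      using comm[of u y] comm[of y u] commutator_minus[of "d y" u] commutator_minus[of "d y" "d u"]
      by simp
    have "commutator (d x) y = commutator (d (d x)) y"
      using comm[of x y] swap[of "d x"] by simp
    then show ?thesis
      by (simp add: 1 commutator_def derivation_imp_zero_symmetric[OF d])
  qed (simp add: commutator_eq_0_iff)
qed

lemma central_derivation_imp_commutative:
  fixes d :: "'a::left_near_ring \<Rightarrow> 'a"
  assumes prime: "three_prime TYPE('a)" and d: "multiplicative_derivation d"
    and nonzero: "\<exists>x. d x \<noteq> 0"
    and central: "\<And>x y. d x * y = y * d x"
  shows "x * y = y * (x::'a)"
proof -
  \<comment> \<open>Expand \<open>w * d (u * v) = d (u * v) * w\<close>; the right side splits only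
    thanks to partial distributivity.\<close>
  have expand: "d v * (w * u) + d u * (w * v) = d v * (u * w) + d u * (v * w)" for u v w
  proof -
    have "d v * (w * u) + d u * (w * v) = w * (u * d v + d u * v)"
      by (simp add: near_ring_distrib_left) (simp add: central mult.assoc)
    also have "\<dots> = w * d (u * v)"
      by (simp add: derivation_mult[OF d])
    also have "\<dots> = d (u * v) * w"
      by (simp only: central)
    also have "\<dots> = (u * d v + d u * v) * w"
      by (simp add: derivation_mult[OF d])
    also have "\<dots> = d v * (u * w) + d u * (v * w)"
      by (simp add: derivation_partial_distrib[OF d]) (simp add: central[symmetric] mult.assoc[symmetric])
    finally show ?thesis .
  qed
  show ?thesis
  proof (cases "d x = 0")
    case False
    \<comment> \<open>With \<open>u = w = x\<close> and \<open>v = y\<close>, the terms containing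
      \<open>d y\<close> coincide and cancel.\<close>
    have "d x * (x * y) = d x * (y * x)"
      using expand[of y x x] by simp
    then show ?thesis
      using central_mult_left_cancel[OF prime central False] by blast
  next
    case True
    obtain v where v: "d v \<noteq> 0" using nonzero by blast
    \<comment> \<open>Here \<open>u = x\<close> and \<open>w = y\<close>: the terms containing
      \<open>d x = 0\<close> vanish by zero symmetry, and the nonzero central \<open>d v\<close> can
      be cancelled.\<close>
    have "d v * (y * x) = d v * (x * y)"
      using expand[of v y x] True by (simp add: derivation_imp_zero_symmetric[OF d])
    then show ?thesis
      using central_mult_left_cancel[OF prime central v] by metis
  qed
qed

lemma commutative_imp_add_commute:
  fixes a b :: "'a::left_near_ring"
  assumes prime: "three_prime TYPE('a)" and comm: "\<And>x y::'a. x * y = y * x"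
  shows "a + b = b + a"
proof (cases "a = 0")
  case False
  have distrib: "(x + y) * z = x * z + y * z" for x y z :: 'a
    using near_ring_distrib_left[of z x y] by (simp add: comm)
  \<comment> \<open>The two expansions share their first and last summands; cancelling these swaps
    the middle pair, and then the nonzero central factor \<open>a\<close> is cancelled.\<close>
  have "(a * a + b * a) + (a * a + b * a) = (a + b) * (a + a)"
    by (simp only: near_ring_distrib_left[of "a + b"] distrib[of _ _ a])
  also have "\<dots> = (a * a + a * a) + (b * a + b * a)"
    by (simp only: distrib[of _ _ "a + a"] near_ring_distrib_left[of a] near_ring_distrib_left[of b])
  finally have "b * a + a * a + b * a = a * a + b * a + b * a"
    by (simp only: add.assoc add_left_cancel)
  then have "b * a + a * a = a * a + b * a"
    by (simp only: add_right_cancel)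
  then have "a * (a + b) = a * (b + a)"
    by (simp add: near_ring_distrib_left comm)
  then show ?thesis
    using central_mult_left_cancel[OF prime comm False] by blast
qed simp

theorem theorem5:
  fixes d :: "'a::left_near_ring \<Rightarrow> 'a"
  assumes "three_prime TYPE('a)"
    and "multiplicative_derivation d"
    and "\<exists>x. d x \<noteq> 0"
    and "\<And>x y. commutator (d x) y = commutator (d x) (d y)"
  shows "class.comm_ring ((+) :: 'a \<Rightarrow> 'a \<Rightarrow> 'a) 0 (-) uminus (*)"
proof -
  have comm: "x * y = y * x" for x y :: 'a
    using central_derivation_imp_commutative[OF assms(1-3)]
      derivation_values_central[OF assms(1,2,4)] by blast
  have add_comm: "x + y = y + x" for x y :: 'a
    using commutative_imp_add_commute[OF assms(1)] comm by blast
  show ?thesis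
  proof unfold_locales
    fix a b c :: 'a
    show "(a + b) * c = a * c + b * c"
      using near_ring_distrib_left[of c a b] by (simp add: comm)
  qed (simp_all add: comm add_comm derivation_imp_zero_symmetric[OF assms(2)])
qed

end
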